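(* Let $K \in \mathcal{B}(\mathcal{H}_n)$ be a positive operator. Then any $K$-dual pair that is $1$-erasure optimal with respect to the operator norm is necessarily a $1$-uniform $K$-dual pair.
   Context: $\mathcal{H}_n$ is an $n$-dimensional Hilbert space (over $\mathbb{R}$ or $\mathbb{C}$), $\mathcal{B}(\mathcal{H}_n)$ is the algebra of bounded linear operators on it, and $N$ is a fixed positive integer. For $K\in\mathcal{B}(\mathcal{H}_n)$, a sequence $F=\{f_i\}_{i=1}^N\subset\mathcal{H}_n$ is a $K$-frame if there are constants $0<A\le B<\infty$ with $A\|K^*f\|^2\le\sum_{i=1}^N|\langle f,f_i\rangle|^2\le B\|f\|^2$ for all $f\in\mathcal{H}_n$. A sequence $G=\{g_i\}_{i=1}^N\subset\mathcal{H}_n$ is a $K$-dual of the $K$-frame $F$ if $Kf=\sum_{i=1}^N\langle f,g_i\rangle f_i$ for all $f\in\mathcal{H}_n$ (equivalently $K^*f=\sum_{i=1}^N\langle f,f_i\rangle g_i$ for all $f$). In this case $(F,G)$ is called an $(N,n)$ $K$-dual pair for $\mathcal{H}_n$. For a $K$-dual pair $(F,G)$, $\mathbb{O}_1(F,G)$ denotes the maximum over $1\le i\le N$ of the operator norm of the error operator $f\mapsto\langle f,f_i\rangle g_i$, i.e. $\mathbb{O}_1(F,G)=\max_{1\le i\le N}\|f_i\|\,\|g_i\|$. Set $\widetilde{\mathbb{O}}_1:=\inf\{\mathbb{O}_1(F,G):(F,G)\text{ is an }(N,n)\ K\text{-dual pair for }\mathcal{H}_n\}$. A $K$-dual pair $(F',G')$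 is $1$-erasure optimal with respect to the operator norm if $\mathbb{O}_1(F',G')=\widetilde{\mathbb{O}}_1$. A $K$-dual pair $(F,G)$ is $1$-uniform if there is a constant $c\in\mathbb{C}$ with $\langle f_i,g_i\rangle=c$ for all $1\le i\le N$. *)

theory Defs
  imports "HOL-Analysis.Analysis"
begin

text \<open>
  A type of this class is a copy of the real or of the complex numbers: the embedding
  \<open>to_complex\<close> is an isometric real-linear field homomorphism, so it is injective and
  its range is either the real line or the whole plane (lemma \<open>range_to_complex\<close>).
\<close>

class real_or_complex = real_normed_field +
  fixes to_complex :: "'a \<Rightarrow> complex"
  assumes to_complex_add: "to_complex (x + y) = to_complex x + to_complex y"
    and to_complex_mult: "to_complex (x * y) = to_complex x * to_complex y"
    and to_complex_one: "to_complex 1 = 1"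
    and to_complex_scaleR: "to_complex (r *\<^sub>R x) = r *\<^sub>R to_complex x"
    and norm_to_complex: "norm (to_complex x) = norm x"

instantiation real :: real_or_complex
begin
definition to_complex_real :: "real \<Rightarrow> complex" where "to_complex_real = complex_of_real"
instance by standard (simp_all add: to_complex_real_def scaleR_conv_of_real)
end

instantiation complex :: real_or_complex
begin
definition to_complex_complex :: "complex \<Rightarrow> complex" where "to_complex_complex = (\<lambda>z. z)"
instance by standard (simp_all add: to_complex_complex_def)
end

lemma to_complex_of_real: "to_complex (of_real r) = of_real r"
  by (simp add: of_real_def to_complex_scaleR to_complex_one)

lemma inj_to_complex: "inj (to_complex :: 'k::real_or_complex \<Rightarrow> complex)"
proof (rule injI)
  fix x y :: 'k
  assume eq: "to_complex x = to_complex y"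
  have "to_complex (x - y) + to_complex y = to_complex x"
    by (simp flip: to_complex_add)
  then have "norm (to_complex (x - y)) = 0"
    using eq by simp
  then show "x = y"
    by (simp add: norm_to_complex)
qed

lemma range_to_complex:
  "range (to_complex :: 'k::real_or_complex \<Rightarrow> complex) = \<real>
   \<or> range (to_complex :: 'k \<Rightarrow> complex) = UNIV"
proof (cases "\<exists>x::'k. Im (to_complex x) \<noteq> 0")
  case False
  then have "range (to_complex :: 'k \<Rightarrow> complex) \<subseteq> \<real>"
    by (auto simp: complex_is_Real_iff)
  moreover have "\<real> \<subseteq> range (to_complex :: 'k \<Rightarrow> complex)"
    by (metis Reals_cases rangeI subsetI to_complex_of_real)
  ultimately show ?thesis by blast
next
  case True
  then obtain x :: 'k where x: "Im (to_complex x) \<noteq> 0" by blast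
  have "z \<in> range (to_complex :: 'k \<Rightarrow> complex)" for z
  proof -
    define b where "b = Im z / Im (to_complex x)"
    define a where "a = Re z - b * Re (to_complex x)"
    have "to_complex (of_real a + of_real b * x) = z"
      unfolding to_complex_add to_complex_mult to_complex_of_real
      using x by (simp add: complex_eq_iff a_def b_def)
    then show ?thesis by blast
  qed
  then show ?thesis by blast
qed

text \<open>
  The norm (hence the topology, boundedness and the operator norm) is that of the type
  class; \<open>ip_self\<close> says that it is the norm induced by the inner product, and so also gives
  positive definiteness. The inner product is linear in its first argument.
\<close>

locale hilbert_space_of_dim = vector_space smul
  for smul :: "'k::real_or_complex \<Rightarrow> 'v::banach \<Rightarrow> 'v" +
  fixes ip :: "'v \<Rightarrow> 'v \<Rightarrow> 'k"
    and n :: nat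
  assumes scale_of_real: "smul (of_real r) x = r *\<^sub>R x"
    and ip_add_left: "ip (x + y) z = ip x z + ip y z"
    and ip_scale_left: "ip (smul c x) y = c * ip x y"
    and ip_conj_sym: "to_complex (ip y x) = cnj (to_complex (ip x y))"
    and ip_self: "ip x x = of_real ((norm x)\<^sup>2)"
    and has_dim: "\<exists>B. finite B \<and> card B = n \<and> independent B \<and> span B = UNIV"

definition bounded_operator ::
  "('k::real_or_complex \<Rightarrow> 'v::banach \<Rightarrow> 'v) \<Rightarrow> ('v \<Rightarrow> 'v) \<Rightarrow> bool" where
  "bounded_operator smul K \<longleftrightarrow>
     bounded_linear K \<and> (\<forall>c x. K (smul c x) = smul c (K x))"

text \<open>
  In a finite-dimensional Hilbert space every linear operator has exactly one adjoint, so the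
  description below is proper.
\<close>

definition hilbert_adjoint ::
  "('v::banach \<Rightarrow> 'v \<Rightarrow> 'k::real_or_complex) \<Rightarrow> ('v \<Rightarrow> 'v) \<Rightarrow> ('v \<Rightarrow> 'v)" where
  "hilbert_adjoint ip K = (THE T. \<forall>x y. ip (K x) y = ip x (T y))"

text \<open>
  Self-adjointness is part of positivity: over the complex numbers it is automatic, over the
  reals it is not.
\<close>

definition positive_operator ::
  "('k::real_or_complex \<Rightarrow> 'v::banach \<Rightarrow> 'v) \<Rightarrow> ('v \<Rightarrow> 'v \<Rightarrow> 'k) \<Rightarrow> ('v \<Rightarrow> 'v) \<Rightarrow> bool" where
  "positive_operator smul ip K \<longleftrightarrow>
     bounded_operator smul K \<and> hilbert_adjoint ip K = K \<and>
     (\<forall>f. \<exists>r\<ge>0. ip (K f) f = of_real r)"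

text \<open>
  A sequence of \<open>N\<close> vectors is a function on \<open>nat\<close> of which only the values on
  \<open>{1..N}\<close> matter.
\<close>

definition K_frame ::
  "('v::banach \<Rightarrow> 'v \<Rightarrow> 'k::real_or_complex) \<Rightarrow> nat \<Rightarrow> ('v \<Rightarrow> 'v) \<Rightarrow> (nat \<Rightarrow> 'v) \<Rightarrow> bool" where
  "K_frame ip N K F \<longleftrightarrow>
     (\<exists>A B. 0 < A \<and> A \<le> B \<and>
        (\<forall>f. A * (norm (hilbert_adjoint ip K f))\<^sup>2 \<le> (\<Sum>i=1..N. (norm (ip f (F i)))\<^sup>2) \<and>
             (\<Sum>i=1..N. (norm (ip f (F i)))\<^sup>2) \<le> B * (norm f)\<^sup>2))"

definition K_dual_pair ::
  "('k::real_or_complex \<Rightarrow> 'v::banach \<Rightarrow> 'v) \<Rightarrow> ('v \<Rightarrow> 'v \<Rightarrow> 'k) \<Rightarrow> nat \<Rightarrow> ('v \<Rightarrow> 'v) \<Rightarrow>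
   (nat \<Rightarrow> 'v) \<Rightarrow> (nat \<Rightarrow> 'v) \<Rightarrow> bool" where
  "K_dual_pair smul ip N K F G \<longleftrightarrow>
     K_frame ip N K F \<and> (\<forall>f. K f = (\<Sum>i=1..N. smul (ip f (G i)) (F i)))"

definition max_erasure_error ::
  "('k::real_or_complex \<Rightarrow> 'v::banach \<Rightarrow> 'v) \<Rightarrow> ('v \<Rightarrow> 'v \<Rightarrow> 'k) \<Rightarrow> nat \<Rightarrow>
   (nat \<Rightarrow> 'v) \<Rightarrow> (nat \<Rightarrow> 'v) \<Rightarrow> real" where
  "max_erasure_error smul ip N F G =
     Max ((\<lambda>i. onorm (\<lambda>f. smul (ip f (F i)) (G i))) ` {1..N})"

definition optimal_erasure_error ::
  "('k::real_or_complex \<Rightarrow> 'v::banach \<Rightarrow> 'v) \<Rightarrow> ('v \<Rightarrow> 'v \<Rightarrow> 'k) \<Rightarrow> nat \<Rightarrow> ('v \<Rightarrow> 'v) \<Rightarrow> real" where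
  "optimal_erasure_error smul ip N K =
     Inf {max_erasure_error smul ip N F G | F G. K_dual_pair smul ip N K F G}"

definition one_erasure_optimal ::
  "('k::real_or_complex \<Rightarrow> 'v::banach \<Rightarrow> 'v) \<Rightarrow> ('v \<Rightarrow> 'v \<Rightarrow> 'k) \<Rightarrow> nat \<Rightarrow> ('v \<Rightarrow> 'v) \<Rightarrow>
   (nat \<Rightarrow> 'v) \<Rightarrow> (nat \<Rightarrow> 'v) \<Rightarrow> bool" where
  "one_erasure_optimal smul ip N K F G \<longleftrightarrow>
     K_dual_pair smul ip N K F G \<and>
     max_erasure_error smul ip N F G = optimal_erasure_error smul ip N K"

definition one_uniform ::
  "('k::real_or_complex \<Rightarrow> 'v::banach \<Rightarrow> 'v) \<Rightarrow> ('v \<Rightarrow> 'v \<Rightarrow> 'k) \<Rightarrow> nat \<Rightarrow> ('v \<Rightarrow> 'v) \<Rightarrow>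
   (nat \<Rightarrow> 'v) \<Rightarrow> (nat \<Rightarrow> 'v) \<Rightarrow> bool" where
  "one_uniform smul ip N K F G \<longleftrightarrow>
     K_dual_pair smul ip N K F G \<and>
     (\<exists>c::complex. \<forall>i\<in>{1..N}. to_complex (ip (F i) (G i)) = c)"

end

theory Submission
  imports Defs
begin

text \<open>
  Write \<open>tr K\<close> for the trace. If \<open>K = (\<Sum>i. \<langle>\<cdot>, g\<^sub>i\<rangle> f\<^sub>i)\<close>, then
  \<open>tr K = (\<Sum>i. \<langle>f\<^sub>i, g\<^sub>i\<rangle>)\<close>, whatever the dual pair (\<open>trace_unique\<close>). The \<open>i\<close>-th erasure error
  is \<open>\<parallel>f\<^sub>i\<parallel> \<parallel>g\<^sub>i\<parallel>\<close> and dominates \<open>\<bar>\<langle>f\<^sub>i, g\<^sub>i\<rangle>\<bar>\<close>, so the maximal error is at least the average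
  \<open>tr K / N\<close>. If it is equal to \<open>tr K / N\<close>, then no summand of the trace exceeds the average in
  modulus, so every one of them is equal to it, and the pair is 1-uniform with constant
  \<open>tr K / N\<close>.

  It remains to see that the bound \<open>tr K / N\<close> is attained as soon as some dual pair of length \<open>N\<close>
  exists. Existence of a dual pair bounds the rank of \<open>K\<close> by \<open>N\<close>. A positive operator of rank at
  most \<open>N\<close> has a symmetric decomposition \<open>K = (\<Sum>i. \<langle>\<cdot>, h\<^sub>i\<rangle> h\<^sub>i)\<close> with \<open>N\<close> terms: as in the
  Cholesky factorization, one splits off rank-one positive operators, each of which lowers the
  rank (\<open>positive_decomposition\<close>). Rotating two of the \<open>h\<^sub>i\<close> in the plane of their indices does
  not change the operator, and by the intermediate value theorem a rotation can bring the norm of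
  one of them to any value between the two; finitely many rotations make all norms equal
  (\<open>equal_norm_decomposition\<close>). The pair \<open>(h, h)\<close> then has all errors \<open>\<parallel>h\<^sub>i\<parallel>\<^sup>2 = tr K / N\<close>.
\<close>

section \<open>The inner product\<close>

context hilbert_space_of_dim
begin

lemma to_complex_0 [simp]: "to_complex (0::'k) = 0"
  using to_complex_of_real[of 0, where ?'a='k] by simp

lemma to_complex_eq_iff: "to_complex (a::'k) = to_complex b \<longleftrightarrow> a = b"
  using inj_to_complex by (auto simp: inj_def)

lemma ip_add_right: "ip x (y + z) = ip x y + ip x z"
proof -
  have "to_complex (ip x (y + z)) = to_complex (ip x y + ip x z)"
    unfolding to_complex_add ip_conj_sym[of x] ip_add_left by (simp add: to_complex_add)
  then show ?thesis by (simp add: to_complex_eq_iff)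
qed

lemma ip_scale_right: "to_complex (ip x (smul c y)) = cnj (to_complex c) * to_complex (ip x y)"
  unfolding ip_conj_sym[of x] ip_scale_left by (simp add: to_complex_mult)

lemma ip_rank_one_right: "ip x (smul (ip y g) h) = ip g y * ip x h"
proof -
  have "to_complex (ip x (smul (ip y g) h)) = to_complex (ip g y * ip x h)"
    by (simp add: ip_scale_right to_complex_mult ip_conj_sym[of g y])
  then show ?thesis by (simp add: to_complex_eq_iff)
qed

lemma ip_scaleR_right: "ip x (r *\<^sub>R y) = of_real r * ip x y"
proof -
  have "to_complex (ip x (r *\<^sub>R y)) = to_complex (of_real r * ip x y)"
    unfolding scale_of_real[symmetric] ip_scale_right
    by (simp add: to_complex_mult to_complex_of_real)
  then show ?thesis by (simp add: to_complex_eq_iff)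
qed

lemma ip_0_left [simp]: "ip 0 y = 0"
  using ip_scale_left[of 0 0 y] by simp

lemma ip_0_right [simp]: "ip x 0 = 0"
  using ip_scaleR_right[of x 0 0] by simp

lemma ip_diff_left: "ip (x - y) z = ip x z - ip y z"
  using ip_add_left[of "x - y" y z] by simp

lemma ip_diff_right: "ip x (y - z) = ip x y - ip x z"
  using ip_add_right[of x "y - z" z] by simp

lemma ip_sum_left: "ip (\<Sum>i\<in>I. h i) y = (\<Sum>i\<in>I. ip (h i) y)"
  by (induction I rule: infinite_finite_induct) (simp_all add: ip_add_left)

lemma ip_sum_right: "ip x (\<Sum>i\<in>I. h i) = (\<Sum>i\<in>I. ip x (h i))"
  by (induction I rule: infinite_finite_induct) (simp_all add: ip_add_right)

lemma ip_self_eq_0: "ip x x = 0 \<longleftrightarrow> x = 0"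
  by (simp add: ip_self)

lemma ip_times_ip_swap: "ip x y * ip y x = of_real ((norm (ip x y))\<^sup>2)"
proof -
  have "to_complex (ip x y * ip y x) = to_complex (of_real ((norm (ip x y))\<^sup>2) :: 'k)"
    unfolding to_complex_of_real to_complex_mult ip_conj_sym[of y x]
    by (simp only: complex_norm_square[symmetric] norm_to_complex)
  then show ?thesis by (simp add: to_complex_eq_iff)
qed

lemma norm_smul: "norm (smul c x) = norm c * norm x"
proof -
  have "complex_of_real ((norm (smul c x))\<^sup>2) = to_complex (ip (smul c x) (smul c x))"
    by (simp only: ip_self to_complex_of_real)
  also have "\<dots> = (to_complex c * cnj (to_complex c)) * to_complex (ip x x)"
    by (simp add: ip_scale_left to_complex_mult ip_scale_right)
  also have "\<dots> = of_real ((norm c)\<^sup>2) * of_real ((norm x)\<^sup>2)"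
    by (simp only: complex_norm_square[symmetric] norm_to_complex ip_self to_complex_of_real)
  finally have "(norm (smul c x))\<^sup>2 = (norm c * norm x)\<^sup>2"
    unfolding of_real_mult[symmetric] of_real_eq_iff by (simp add: power_mult_distrib)
  then show ?thesis by (simp add: power2_eq_iff_nonneg)
qed

lemma norm_ip_le: "norm (ip f g) \<le> norm f * norm g"
proof (cases "g = 0")
  case True then show ?thesis by simp
next
  case False
  define a where "a = ip f g / of_real ((norm g)\<^sup>2)"
  have orth: "ip (f - smul a g) g = 0"
    using False by (simp add: ip_diff_left ip_scale_left ip_self a_def)
  have "(of_real ((norm (f - smul a g))\<^sup>2) :: 'k) = ip (f - smul a g) (f - smul a g)"
    by (simp only: ip_self)
  also have "\<dots> = ip (f - smul a g) f - ip (f - smul a g) (smul a g)"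
    by (rule ip_diff_right)
  also have "ip (f - smul a g) (smul a g) = 0"
    using ip_scale_right[of "f - smul a g" a g] orth to_complex_eq_iff[of _ 0] by simp
  also have "ip (f - smul a g) f - 0 = ip f f - (ip f g * ip g f) / of_real ((norm g)\<^sup>2)"
    by (simp add: ip_diff_left ip_scale_left a_def)
  also have "\<dots> = of_real ((norm f)\<^sup>2 - (norm (ip f g))\<^sup>2 / (norm g)\<^sup>2)"
    unfolding ip_times_ip_swap ip_self by simp
  finally have "(norm f)\<^sup>2 - (norm (ip f g))\<^sup>2 / (norm g)\<^sup>2 = (norm (f - smul a g))\<^sup>2"
    unfolding of_real_eq_iff by simp
  then have "(norm (ip f g))\<^sup>2 / (norm g)\<^sup>2 \<le> (norm f)\<^sup>2"
    using zero_le_power2[of "norm (f - smul a g)"] by linarith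
  then have "(norm (ip f g))\<^sup>2 \<le> (norm f * norm g)\<^sup>2"
    using False by (simp add: pos_divide_le_eq power_mult_distrib)
  then show ?thesis by (rule power2_le_imp_le) simp
qed

lemma onorm_rank_one: "onorm (\<lambda>f. smul (ip f u) v) = norm u * norm v"
proof (rule antisym)
  have bound: "norm (smul (ip f u) v) \<le> (norm u * norm v) * norm f" for f
    using mult_right_mono[OF norm_ip_le[of f u] norm_ge_zero[of v]]
    by (simp add: norm_smul mult_ac)
  show "onorm (\<lambda>f. smul (ip f u) v) \<le> norm u * norm v"
    by (rule onorm_bound) (simp_all add: bound)
  have lin: "bounded_linear (\<lambda>f. smul (ip f u) v)"
  proof (rule bounded_linear_intro[where K = "norm u * norm v"])
    show "smul (ip (x + y) u) v = smul (ip x u) v + smul (ip y u) v" for x y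
      by (simp add: ip_add_left scale_left_distrib)
    show "smul (ip (r *\<^sub>R x) u) v = r *\<^sub>R smul (ip x u) v" for r x
      by (simp add: scale_of_real[symmetric] ip_scale_left)
  qed (use bound in \<open>simp add: mult_ac\<close>)
  show "norm u * norm v \<le> onorm (\<lambda>f. smul (ip f u) v)"
  proof (cases "u = 0")
    case True
    then show ?thesis using onorm_pos_le[OF lin] by simp
  next
    case False
    have "norm (ip u u) = norm u * norm u"
      by (simp add: ip_self power2_eq_square norm_mult)
    then have "(norm u * norm v) * norm u \<le> onorm (\<lambda>f. smul (ip f u) v) * norm u"
      using onorm[OF lin, of u] by (simp add: norm_smul mult_ac)
    with False show ?thesis by (simp add: mult.commute)
  qed
qed

section \<open>Sums of rank-one operators, their trace and their adjoint\<close>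

definition rank_one_sum :: "'i set \<Rightarrow> ('i \<Rightarrow> 'v) \<Rightarrow> ('i \<Rightarrow> 'v) \<Rightarrow> 'v \<Rightarrow> 'v" where
  "rank_one_sum I F G f = (\<Sum>i\<in>I. smul (ip f (G i)) (F i))"

text \<open>
  Expanding each \<open>F i\<close> in the basis \<open>B\<close> turns the sum of the \<open>\<langle>F i, G i\<rangle>\<close> into the sum of the diagonal entries of the matrix of the operator with respect to \<open>B\<close>.
\<close>

lemma trace_in_basis:
  assumes "finite B" "independent B" "span B = UNIV"
  shows "(\<Sum>i\<in>I. ip (F i) (G i)) = (\<Sum>b\<in>B. representation B (rank_one_sum I F G b) b)"
proof -
  have expand: "ip (F i) (G i) = (\<Sum>b\<in>B. representation B (F i) b * ip b (G i))" for i
  proof -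
    have "F i = (\<Sum>b\<in>B. smul (representation B (F i) b) b)"
      using assms by (intro sum_representation_eq[symmetric]) auto
    then have "ip (F i) (G i) = ip (\<Sum>b\<in>B. smul (representation B (F i) b) b) (G i)"
      by simp
    then show ?thesis by (simp add: ip_sum_left ip_scale_left)
  qed
  have "representation B (rank_one_sum I F G b) b
      = (\<Sum>i\<in>I. representation B (F i) b * ip b (G i))" for b
    unfolding rank_one_sum_def
    using assms by (simp add: representation_sum representation_scale mult.commute)
  then show ?thesis
    unfolding expand by (simp add: sum.swap[of _ B I])
qed

lemma trace_unique:
  assumes "rank_one_sum I F G = rank_one_sum J F' G'"
  shows "(\<Sum>i\<in>I. ip (F i) (G i)) = (\<Sum>j\<in>J. ip (F' j) (G' j))"
proof -
  obtain B where "finite B" "independent B" "span B = UNIV"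
    using has_dim by blast
  then show ?thesis by (simp add: trace_in_basis assms)
qed

lemma ip_adjoint_rank_one_sum:
  "ip (rank_one_sum I F G x) y = ip x (rank_one_sum I G F y)"
  by (simp add: rank_one_sum_def ip_sum_left ip_sum_right ip_scale_left ip_rank_one_right
      mult.commute)

lemma adjoint_rank_one_sum:
  "hilbert_adjoint ip (rank_one_sum I F G) = rank_one_sum I G F"
  unfolding hilbert_adjoint_def
proof (rule the_equality)
  show adj: "\<forall>x y. ip (rank_one_sum I F G x) y = ip x (rank_one_sum I G F y)"
    by (simp add: ip_adjoint_rank_one_sum)
  fix T assume "\<forall>x y. ip (rank_one_sum I F G x) y = ip x (T y)"
  then have "ip x (T y - rank_one_sum I G F y) = 0" for x y
    using adj by (simp add: ip_diff_right)
  then have "T y - rank_one_sum I G F y = 0" for y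
    using ip_self_eq_0 by blast
  then show "T = rank_one_sum I G F" by auto
qed

text \<open>
  The frame property comes for free in the symmetric case: by Cauchy--Schwarz,
  \<open>\<parallel>K f\<parallel>\<^sup>2\<close> is at most \<open>\<Sum>\<parallel>h\<^sub>i\<parallel>\<^sup>2\<close> times \<open>\<Sum>\<bar>\<langle>f, h\<^sub>i\<rangle>\<bar>\<^sup>2\<close>, and
  the latter sum is at most \<open>(\<Sum>\<parallel>h\<^sub>i\<parallel>\<^sup>2) \<parallel>f\<parallel>\<^sup>2\<close>. Adding 1 to \<open>\<Sum>\<parallel>h\<^sub>i\<parallel>\<^sup>2\<close> keeps the frame
  constants positive when all \<open>h\<^sub>i\<close> vanish.
\<close>

lemma K_dual_pair_symmetric:
  assumes "K = rank_one_sum {1..N} h h" "hilbert_adjoint ip K = K"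
  shows "K_dual_pair smul ip N K h h"
proof -
  define S where "S = (\<Sum>i=1..N. (norm (h i))\<^sup>2)"
  have S0: "0 \<le> S" by (simp add: S_def sum_nonneg)
  have lower: "1 / (1 + S) * (norm (K f))\<^sup>2 \<le> (\<Sum>i=1..N. (norm (ip f (h i)))\<^sup>2)" (is "_ \<le> ?Q") for f
  proof -
    have "norm (K f) \<le> (\<Sum>i=1..N. norm (ip f (h i)) * norm (h i))"
      unfolding assms(1) rank_one_sum_def
      by (rule order_trans[OF norm_sum]) (simp add: norm_smul)
    then have "(norm (K f))\<^sup>2 \<le> (\<Sum>i=1..N. norm (ip f (h i)) * norm (h i))\<^sup>2"
      by (simp add: power_mono)
    also have "\<dots> \<le> ?Q * S"
      unfolding S_def by (rule Cauchy_Schwarz_ineq_sum)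
    also have "\<dots> \<le> ?Q * (1 + S)"
      by (intro mult_left_mono sum_nonneg) auto
    finally show ?thesis using S0 by (simp add: pos_divide_le_eq)
  qed
  have upper: "(\<Sum>i=1..N. (norm (ip f (h i)))\<^sup>2) \<le> (1 + S) * (norm f)\<^sup>2" for f
  proof -
    have "(norm (ip f (h i)))\<^sup>2 \<le> (norm (h i))\<^sup>2 * (norm f)\<^sup>2" for i
      using power_mono[OF norm_ip_le[of f "h i"] norm_ge_zero, of 2]
      by (simp add: power_mult_distrib mult.commute)
    then have "(\<Sum>i=1..N. (norm (ip f (h i)))\<^sup>2) \<le> (\<Sum>i=1..N. (norm (h i))\<^sup>2 * (norm f)\<^sup>2)"
      by (intro sum_mono)
    also have "\<dots> = S * (norm f)\<^sup>2"
      by (simp add: S_def sum_distrib_right)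
    also have "\<dots> \<le> (1 + S) * (norm f)\<^sup>2"
      by (intro mult_right_mono) auto
    finally show ?thesis .
  qed
  have "1 / (1 + S) \<le> 1" using S0 by simp
  then have "1 / (1 + S) \<le> 1 + S" using S0 by linarith
  moreover have "0 < 1 / (1 + S)" using S0 by simp
  ultimately have "K_frame ip N K h"
    unfolding K_frame_def assms(2) using lower upper by blast
  then show ?thesis
    by (simp add: K_dual_pair_def assms(1) rank_one_sum_def)
qed

section \<open>Symmetric decompositions of positive operators\<close>

text \<open>
  Self-adjointness is expressed as symmetry of the form \<open>\<langle>K x, y\<rangle>\<close> rather than through
  \<^const>\<open>hilbert_adjoint\<close>, because this is an identity that the inductive construction below can
  verify directly for each new operator.
\<close>

definition positive :: "('v \<Rightarrow> 'v) \<Rightarrow> bool" where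
  "positive K \<longleftrightarrow> (\<forall>x y. K (x + y) = K x + K y) \<and> (\<forall>c x. K (smul c x) = smul c (K x)) \<and>
     (\<forall>x y. ip (K x) y = ip x (K y)) \<and> (\<forall>f. \<exists>r\<ge>0. ip (K f) f = of_real r)"

text \<open>
  Polarization with the vectors \<open>v\<close> and \<open>K v\<close>: the cross terms add up to \<open>2 \<parallel>K v\<parallel>\<^sup>2\<close>.
\<close>

lemma positive_eq_0:
  assumes "positive K" "\<And>v. ip (K v) v = 0"
  shows "K v = 0"
proof -
  have add: "K (x + y) = K x + K y" and sa: "ip (K x) y = ip x (K y)" for x y
    using assms(1) by (auto simp: positive_def)
  have "0 = ip (K (v + K v)) (v + K v)"
    using assms(2) by simp
  also have "\<dots> = ip (K v) (K v) + ip (K (K v)) v"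
    by (simp add: add ip_add_left ip_add_right assms(2))
  also have "\<dots> = 2 * ip (K v) (K v)"
    by (simp add: sa[of "K v" v])
  finally show ?thesis by (simp add: ip_self_eq_0)
qed

text \<open>
  One Cholesky step. With \<open>\<langle>K v, v\<rangle> = r > 0\<close>, the new operator is \<open>K - \<langle>\<cdot>, h\<rangle> h\<close> for
  \<open>h = K v / \<surd>r\<close>, and \<open>h\<close> is chosen so that the values of the new operator are orthogonal to \<open>v\<close>.
  The new operator is also \<open>f \<mapsto> K (f - a v)\<close> with \<open>a = \<langle>f, K v\<rangle> / r\<close>; hence its quadratic form
  at \<open>f\<close> is that of \<open>K\<close> at \<open>f - a v\<close>, and it is positive.
\<close>

lemma positive_split_off:
  assumes K: "positive K" and r: "ip (K v) v = of_real r" "r > 0"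
  defines "h \<equiv> (1 / sqrt r) *\<^sub>R K v"
  defines "K' \<equiv> \<lambda>f. K f - smul (ip f h) h"
  shows "positive K'" and "\<And>f. ip (K' f) v = 0" and "\<And>f. K' f \<in> range K"
proof -
  have add: "K (x + y) = K x + K y" and sc: "K (smul c x) = smul c (K x)"
    and sa: "ip (K x) y = ip x (K y)" and pos: "\<exists>r\<ge>0. ip (K x) x = of_real r" for x y c
    using K by (auto simp: positive_def)
  define a where "a f = ip f (K v) / of_real r" for f
  have diff: "K (x - y) = K x - K y" for x y
    using add[of "x - y" y] by simp
  have sq: "1 / sqrt r * (1 / sqrt r) = 1 / r"
    using r(2) by (simp flip: real_sqrt_mult)
  have "smul (ip f h) h = smul (a f) (K v)" for f
  proof -
    have "smul (ip f h) h = smul (of_real (1 / sqrt r * (1 / sqrt r)) * ip f (K v)) (K v)"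
      unfolding h_def ip_scaleR_right
      unfolding scale_of_real[symmetric] scale_scale
      by (simp only: of_real_mult mult_ac)
    also have "of_real (1 / sqrt r * (1 / sqrt r)) * ip f (K v) = a f"
      unfolding sq a_def by simp
    finally show ?thesis .
  qed
  then have K'_alt: "K' f = K (f - smul (a f) v)" for f
    by (simp add: K'_def diff sc)
  then show "K' f \<in> range K" for f by simp
  show orth: "ip (K' f) v = 0" for f
    unfolding K'_alt diff sc ip_diff_left ip_scale_left r(1)
    using r(2) by (simp add: a_def sa)
  show "positive K'"
    unfolding positive_def
  proof (intro conjI allI)
    show "K' (x + y) = K' x + K' y" for x y
      by (simp add: K'_def add ip_add_left scale_left_distrib)
    show "K' (smul c x) = smul c (K' x)" for c x
      by (simp add: K'_def sc ip_scale_left scale_right_diff_distrib)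
    show "ip (K' x) y = ip x (K' y)" for x y
      by (simp add: K'_def ip_diff_left ip_diff_right ip_scale_left ip_rank_one_right sa
          mult.commute)
    fix f
    have "ip (K' f) (smul (a f) v) = 0"
      using ip_scale_right[of "K' f" "a f" v] orth to_complex_eq_iff[of _ 0] by simp
    then have "ip (K' f) f = ip (K (f - smul (a f) v)) (f - smul (a f) v)"
      by (simp add: ip_diff_right flip: K'_alt)
    then show "\<exists>r\<ge>0. ip (K' f) f = of_real r"
      using pos by simp
  qed
qed

text \<open>
  Every split-off step strictly decreases the range: the values of the new operator are orthogonal
  to \<open>v\<close>, but \<open>K v\<close> is not.
\<close>

lemma positive_decomposition:
  assumes "finite I" "positive K" "dim (range K) \<le> card I"
  shows "\<exists>h. K = rank_one_sum I h h"
  using assms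
proof (induction I arbitrary: K rule: finite_induct)
  obtain B where "finite B" "independent B" "span B = UNIV"
    using has_dim by blast
  then interpret fd: finite_dimensional_vector_space smul B
    by unfold_locales
  {
    case empty
    then have "range K \<subseteq> {0}" by simp
    then show ?case by (auto simp: rank_one_sum_def)
  next
    case (insert i I)
    show ?case
    proof (cases "\<forall>v. ip (K v) v = 0")
      case True
      then have "K = rank_one_sum (insert i I) (\<lambda>_. 0) (\<lambda>_. 0)"
        using positive_eq_0[OF insert.prems(1)] by (auto simp: rank_one_sum_def)
      then show ?thesis by blast
    next
      case False
      then obtain v where v: "ip (K v) v \<noteq> 0" by blast
      obtain r where r: "r \<ge> 0" "ip (K v) v = of_real r"
        using insert.prems(1) unfolding positive_def by blast
      with v have "r > 0" by (cases "r = 0") auto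
      define u where "u = (1 / sqrt r) *\<^sub>R K v"
      define K' where "K' = (\<lambda>f. K f - smul (ip f u) u)"
      have step: "positive K'" "ip (K' f) v = 0" "K' f \<in> range K" for f
        unfolding K'_def u_def
        by (rule positive_split_off[OF insert.prems(1) r(2) \<open>r > 0\<close>])+
      have "subspace {y. ip y v = 0}"
        by (auto simp: subspace_def ip_add_left ip_scale_left)
      then have "span (range K') \<subseteq> {y. ip y v = 0}"
        using step(2) by (intro span_minimal) auto
      with v have "K v \<notin> span (range K')" by auto
      moreover have "span (range K') \<subseteq> span (range K)"
        using step(3) by (intro span_mono) auto
      moreover have "K v \<in> span (range K)"
        by (simp add: span_base)
      ultimately have "dim (range K') < dim (range K)"
        by (intro fd.dim_psubset) auto
      then have "dim (range K') \<le> card I"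
        using insert.prems(2) insert.hyps by simp
      from insert.IH[OF step(1) this] obtain h where h: "K' = rank_one_sum I h h"
        by blast
      have "K f = rank_one_sum (insert i I) (h(i := u)) (h(i := u)) f" for f
      proof -
        have "K f = K' f + smul (ip f u) u" by (simp add: K'_def)
        also have "K' f = (\<Sum>j\<in>I. smul (ip f ((h(i := u)) j)) ((h(i := u)) j))"
          unfolding h rank_one_sum_def using insert.hyps by (intro sum.cong) auto
        finally show ?thesis
          using insert.hyps by (simp add: rank_one_sum_def add.commute)
      qed
      then show ?thesis by blast
    qed
  }
qed

section \<open>Equalizing the norms by rotations\<close>

lemma rank_one_sum_remove:
  assumes "finite I" "i \<in> I"
  shows "rank_one_sum I F G f = smul (ip f (G i)) (F i) + rank_one_sum (I - {i}) F G f"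
  unfolding rank_one_sum_def using assms by (rule sum.remove)

text \<open>
  Writing \<open>\<langle>\<cdot>, a\<rangle> a + \<langle>\<cdot>, b\<rangle> b\<close> as \<open>T T\<^sup>*\<close> with \<open>T = (a, b)\<close>, a rotation \<open>R\<close> replaces \<open>T\<close> by
  \<open>T R\<close>, and \<open>R R\<^sup>*\<close> is the identity.
\<close>

lemma rank_one_sum_rotate:
  fixes c s :: real and a b :: 'v
  assumes "c\<^sup>2 + s\<^sup>2 = 1"
  defines "x \<equiv> c *\<^sub>R a + s *\<^sub>R b" and "y \<equiv> c *\<^sub>R b - s *\<^sub>R a"
  shows "smul (ip f x) x + smul (ip f y) y = smul (ip f a) a + smul (ip f b) b"
proof -
  let ?c = "of_real c :: 'k" and ?s = "of_real s :: 'k"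
  let ?p = "ip f a" and ?q = "ip f b"
  have cs: "?c * ?c + ?s * ?s = 1"
    using arg_cong[OF assms(1), of "of_real :: real \<Rightarrow> 'k"] by (simp add: power2_eq_square)
  have "ip f x = ?c * ?p + ?s * ?q" and "ip f y = ?c * ?q - ?s * ?p"
    by (simp_all add: x_def y_def ip_add_right ip_diff_right ip_scaleR_right)
  then have "smul (ip f x) x + smul (ip f y) y
      = smul ((?c * ?p + ?s * ?q) * ?c - (?c * ?q - ?s * ?p) * ?s) a
      + smul ((?c * ?p + ?s * ?q) * ?s + (?c * ?q - ?s * ?p) * ?c) b"
    unfolding x_def y_def scale_of_real[symmetric]
    by (simp add: scale_right_distrib scale_right_diff_distrib scale_left_distrib
        scale_left_diff_distrib)
  also have "(?c * ?p + ?s * ?q) * ?c - (?c * ?q - ?s * ?p) * ?s = (?c * ?c + ?s * ?s) * ?p"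
    by (simp add: algebra_simps)
  also have "(?c * ?p + ?s * ?q) * ?s + (?c * ?q - ?s * ?p) * ?c = (?c * ?c + ?s * ?s) * ?q"
    by (simp add: algebra_simps)
  finally show ?thesis by (simp add: cs)
qed

lemma sum_norm_sq_unique:
  assumes "rank_one_sum I h h = rank_one_sum J k k"
  shows "(\<Sum>i\<in>I. (norm (h i))\<^sup>2) = (\<Sum>j\<in>J. (norm (k j))\<^sup>2)"
proof -
  have "(of_real (\<Sum>i\<in>I. (norm (h i))\<^sup>2) :: 'k) = of_real (\<Sum>j\<in>J. (norm (k j))\<^sup>2)"
    using trace_unique[OF assms] by (simp add: ip_self)
  then show ?thesis by (simp only: of_real_eq_iff)
qed

lemma rotation_intermediate_norm:
  fixes a b :: 'v
  assumes "(norm a)\<^sup>2 \<le> t" "t \<le> (norm b)\<^sup>2"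
  obtains c s :: real where "c\<^sup>2 + s\<^sup>2 = 1" "(norm (c *\<^sub>R a + s *\<^sub>R b))\<^sup>2 = t"
proof -
  let ?g = "\<lambda>\<theta>::real. (norm (cos \<theta> *\<^sub>R a + sin \<theta> *\<^sub>R b))\<^sup>2"
  have "\<exists>\<theta>\<ge>0. \<theta> \<le> pi / 2 \<and> ?g \<theta> = t"
    by (rule IVT') (use assms in \<open>auto intro!: continuous_intros\<close>)
  then show ?thesis using that by (metis sin_cos_squared_add2)
qed

text \<open>
  Unless all squared norms are equal to their average \<open>t\<close>, one of them is below and another
  above \<open>t\<close>. Rotating the two vectors brings one of the squared norms to \<open>t\<close>. As the sum of all
  squared norms is the trace, it is unchanged, so the average over the other indices is still
  \<open>t\<close>, and the rotated vector can be set aside.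
\<close>

lemma equal_norm_decomposition:
  assumes "finite I" "(\<Sum>i\<in>I. (norm (h i))\<^sup>2) = of_nat (card I) * t"
  shows "\<exists>k. rank_one_sum I k k = rank_one_sum I h h \<and> (\<forall>i\<in>I. (norm (k i))\<^sup>2 = t)"
  using assms
proof (induction "card I" arbitrary: I h)
  case 0
  then show ?case by auto
next
  case (Suc m)
  show ?case
  proof (cases "\<forall>i\<in>I. (norm (h i))\<^sup>2 = t")
    case True
    then show ?thesis by blast
  next
    case False
    have sum0: "(\<Sum>i\<in>I. (norm (h i))\<^sup>2) = (\<Sum>i\<in>I. t)"
      using Suc.prems(2) by simp
    have "\<exists>i\<in>I. (norm (h i))\<^sup>2 < t"
    proof (rule ccontr)
      assume "\<not> ?thesis"
      then have ge: "t \<le> (norm (h i))\<^sup>2" if "i \<in> I" for i using that by force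
      have "\<exists>i\<in>I. t < (norm (h i))\<^sup>2" using False ge by force
      then have "(\<Sum>i\<in>I. t) < (\<Sum>i\<in>I. (norm (h i))\<^sup>2)"
        by (intro sum_strict_mono_ex1 Suc.prems(1)) (use ge in auto)
      with sum0 show False by simp
    qed
    then obtain i where i: "i \<in> I" "(norm (h i))\<^sup>2 < t" by blast
    have "\<exists>j\<in>I. t < (norm (h j))\<^sup>2"
    proof (rule ccontr)
      assume "\<not> ?thesis"
      then have le: "(norm (h j))\<^sup>2 \<le> t" if "j \<in> I" for j using that by force
      have "(\<Sum>i\<in>I. (norm (h i))\<^sup>2) < (\<Sum>i\<in>I. t)"
        by (intro sum_strict_mono_ex1 Suc.prems(1)) (use le i in auto)
      with sum0 show False by simp
    qed
    then obtain j where j: "j \<in> I" "t < (norm (h j))\<^sup>2" by blast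
    from i j have ij: "i \<noteq> j" by auto
    obtain c s :: real where cs: "c\<^sup>2 + s\<^sup>2 = 1" "(norm (c *\<^sub>R h i + s *\<^sub>R h j))\<^sup>2 = t"
      using rotation_intermediate_norm[of "h i" t "h j"] i j by auto
    define k where "k = h(i := c *\<^sub>R h i + s *\<^sub>R h j, j := c *\<^sub>R h j - s *\<^sub>R h i)"
    have split: "rank_one_sum I g g f
        = (smul (ip f (g i)) (g i) + smul (ip f (g j)) (g j)) + rank_one_sum (I - {i} - {j}) g g f"
      for g f
      using rank_one_sum_remove[of I i g g f] rank_one_sum_remove[of "I - {i}" j g g f]
        Suc.prems(1) i(1) j(1) ij by (simp add: add.assoc)
    have rest: "rank_one_sum (I - {i} - {j}) k k f = rank_one_sum (I - {i} - {j}) h h f" for f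
      unfolding rank_one_sum_def by (intro sum.cong) (auto simp: k_def)
    have op_k: "rank_one_sum I k k = rank_one_sum I h h"
    proof
      fix f
      show "rank_one_sum I k k f = rank_one_sum I h h f"
        unfolding split[of k] split[of h] rest
        using rank_one_sum_rotate[OF cs(1), of f "h i" "h j"] ij by (simp add: k_def)
    qed
    have ki: "(norm (k i))\<^sup>2 = t" using cs(2) ij by (simp add: k_def)
    have card: "m = card (I - {i})" using Suc.hyps(2) Suc.prems(1) i(1) by simp
    have "(\<Sum>l\<in>I. (norm (k l))\<^sup>2) = of_nat (card I) * t"
      using sum_norm_sq_unique[OF op_k] Suc.prems(2) by simp
    then have "(\<Sum>l\<in>I - {i}. (norm (k l))\<^sup>2) = of_nat (card (I - {i})) * t"
      using sum.remove[OF Suc.prems(1) i(1), of "\<lambda>l. (norm (k l))\<^sup>2"] ki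
      by (simp flip: Suc.hyps(2) card add: algebra_simps)
    from Suc.hyps(1)[OF card _ this] Suc.prems(1) obtain k'
      where k': "rank_one_sum (I - {i}) k' k' = rank_one_sum (I - {i}) k k"
        "\<forall>l\<in>I - {i}. (norm (k' l))\<^sup>2 = t"
      by auto
    have "rank_one_sum (I - {i}) (k'(i := k i)) (k'(i := k i)) f
        = rank_one_sum (I - {i}) k' k' f" for f
      unfolding rank_one_sum_def by (intro sum.cong) auto
    then have "rank_one_sum I (k'(i := k i)) (k'(i := k i)) = rank_one_sum I k k"
      unfolding fun_eq_iff rank_one_sum_remove[OF Suc.prems(1) i(1)] by (simp add: k'(1))
    moreover have "\<forall>l\<in>I. (norm ((k'(i := k i)) l))\<^sup>2 = t"
      using k'(2) ki by auto
    ultimately show ?thesis using op_k by (intro exI[of _ "k'(i := k i)"]) simp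
  qed
qed

section \<open>The optimal error and 1-uniformity\<close>

lemma max_erasure_error_eq:
  "max_erasure_error smul ip N F G = Max ((\<lambda>i. norm (F i) * norm (G i)) ` {1..N})"
  by (simp add: max_erasure_error_def onorm_rank_one)

lemma dual_pair_eq_rank_one_sum:
  "K_dual_pair smul ip N K F G \<Longrightarrow> K = rank_one_sum {1..N} F G"
  by (auto simp: K_dual_pair_def rank_one_sum_def)

lemma positive_operator_imp_positive:
  assumes "positive_operator smul ip K" "K = rank_one_sum I F G"
  shows "positive K"
proof -
  have "rank_one_sum I G F = K"
    using assms adjoint_rank_one_sum[of I F G] by (simp add: positive_operator_def)
  then have "ip (K x) y = ip x (K y)" for x y
    using ip_adjoint_rank_one_sum[of I F G x y] assms(2) by simp
  then show ?thesis
    using assms(1)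
    by (auto simp: positive_def positive_operator_def bounded_operator_def linear_simps)
qed

text \<open>
  Here \<open>t\<close> is \<open>tr K / N\<close>. It is real because the trace can also be computed from a symmetric
  decomposition, and it is the erasure error of such a decomposition with equal norms.
\<close>

lemma optimal_error_le_average_trace:
  assumes K: "positive_operator smul ip K" and "N > 0" and FG: "K_dual_pair smul ip N K F G"
  obtains t :: real where "(\<Sum>i=1..N. ip (F i) (G i)) = of_real (of_nat N * t)"
    and "optimal_erasure_error smul ip N K \<le> t"
proof -
  note K_FG = dual_pair_eq_rank_one_sum[OF FG]
  have "range K \<subseteq> span (F ` {1..N})"
    unfolding K_FG rank_one_sum_def by (auto intro!: span_sum span_scale intro: span_base)
  then have "dim (range K) \<le> card (F ` {1..N})"
    by (rule dim_le_card) simp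
  also have "\<dots> \<le> card {1..N}"
    by (rule card_image_le) simp
  finally obtain h where h: "K = rank_one_sum {1..N} h h"
    using positive_decomposition[OF _ positive_operator_imp_positive[OF K K_FG]] by blast
  define t where "t = (\<Sum>i=1..N. (norm (h i))\<^sup>2) / of_nat N"
  have t: "(\<Sum>i=1..N. (norm (h i))\<^sup>2) = of_nat N * t"
    using \<open>N > 0\<close> by (simp add: t_def)
  obtain k where k: "rank_one_sum {1..N} k k = K" "\<forall>i\<in>{1..N}. (norm (k i))\<^sup>2 = t"
    using equal_norm_decomposition[of "{1..N}" h t] t h by auto
  have "(\<Sum>i=1..N. ip (F i) (G i)) = (\<Sum>i=1..N. ip (h i) (h i))"
    by (rule trace_unique[OF trans[OF K_FG[symmetric] h]])
  also have "\<dots> = of_real (of_nat N * t)"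
    unfolding t[symmetric] by (simp add: ip_self)
  finally have trace: "(\<Sum>i=1..N. ip (F i) (G i)) = of_real (of_nat N * t)" .
  have "K_dual_pair smul ip N K k k"
    using K k(1) by (intro K_dual_pair_symmetric) (auto simp: positive_operator_def)
  moreover have "max_erasure_error smul ip N k k = t"
  proof -
    have "(\<lambda>i. norm (k i) * norm (k i)) ` {1..N} = {t}"
      using k(2) \<open>N > 0\<close> by (force simp: power2_eq_square image_iff)
    then show ?thesis unfolding max_erasure_error_eq by simp
  qed
  moreover have "0 \<le> max_erasure_error smul ip N F' G'" for F' G' :: "nat \<Rightarrow> 'v"
    unfolding max_erasure_error_eq using \<open>N > 0\<close>
    by (intro order_trans[OF _ Max_ge[of _ "norm (F' 1) * norm (G' 1)"]]) auto
  ultimately have "optimal_erasure_error smul ip N K \<le> t"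
    unfolding optimal_erasure_error_def
    by (intro cInf_lower bdd_belowI[of _ 0]) auto
  with trace show ?thesis by (rule that)
qed

end

text \<open>
  The equality case of \<open>Re z \<le> \<bar>z\<bar>\<close> and of the comparison of a sum with its largest term.
\<close>

lemma complex_eq_bound_if_sum_maximal:
  fixes z :: "'i \<Rightarrow> complex"
  assumes "finite I" and bound: "\<And>i. i \<in> I \<Longrightarrow> norm (z i) \<le> t"
    and sum: "(\<Sum>i\<in>I. z i) = of_real (of_nat (card I) * t)" and "i \<in> I"
  shows "z i = of_real t"
proof -
  have Re_le: "Re (z j) \<le> t" if "j \<in> I" for j
    using bound[OF that] complex_Re_le_cmod[of "z j"] by linarith
  have "(\<Sum>j\<in>I. t - Re (z j)) = 0"
    using arg_cong[OF sum, of Re] by (simp add: sum_subtractf)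
  then have Re: "Re (z i) = t"
    using sum_nonneg_eq_0_iff[OF \<open>finite I\<close>, of "\<lambda>j. t - Re (z j)"] Re_le \<open>i \<in> I\<close> by simp
  have "(Re (z i))\<^sup>2 + (Im (z i))\<^sup>2 \<le> t\<^sup>2"
    using power_mono[OF bound[OF \<open>i \<in> I\<close>] norm_ge_zero, of 2] by (simp add: cmod_power2)
  then have "Im (z i) = 0" by (simp add: Re)
  with Re show ?thesis by (simp add: complex_eq_iff)
qed

theorem corollary3p6:
  fixes smul :: "'k::real_or_complex \<Rightarrow> 'v::banach \<Rightarrow> 'v"
    and ip :: "'v \<Rightarrow> 'v \<Rightarrow> 'k"
    and n N :: nat
    and K :: "'v \<Rightarrow> 'v"
    and F G :: "nat \<Rightarrow> 'v"
  assumes "hilbert_space_of_dim smul ip n"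
    and "N > 0"
    and "positive_operator smul ip K"
    and "one_erasure_optimal smul ip N K F G"
  shows "one_uniform smul ip N K F G"
proof -
  interpret hilbert_space_of_dim smul ip n by fact
  have FG: "K_dual_pair smul ip N K F G"
    and opt: "max_erasure_error smul ip N F G = optimal_erasure_error smul ip N K"
    using assms(4) by (auto simp: one_erasure_optimal_def)
  obtain t where trace: "(\<Sum>i=1..N. ip (F i) (G i)) = of_real (of_nat N * t)"
    and le_t: "optimal_erasure_error smul ip N K \<le> t"
    using optimal_error_le_average_trace[OF assms(3,2) FG] by blast
  have bound: "norm (to_complex (ip (F i) (G i))) \<le> t" if "i \<in> {1..N}" for i
  proof -
    have "norm (ip (F i) (G i)) \<le> norm (F i) * norm (G i)"
      by (rule norm_ip_le)
    also have "\<dots> \<le> max_erasure_error smul ip N F G"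
      unfolding max_erasure_error_eq using that by (intro Max_ge) auto
    finally show ?thesis using opt le_t by (simp add: norm_to_complex)
  qed
  have "(\<Sum>i\<in>I. to_complex (ip (F i) (G i))) = to_complex (\<Sum>i\<in>I. ip (F i) (G i))" for I
    by (induction I rule: infinite_finite_induct) (simp_all add: to_complex_add)
  from this[of "{1..N}"]
  have "(\<Sum>i=1..N. to_complex (ip (F i) (G i))) = of_real (of_nat (card {1..N}) * t)"
    by (simp only: trace to_complex_of_real card_atLeastAtMost diff_Suc_1 add_diff_cancel_right'
        Suc_eq_plus1)
  from complex_eq_bound_if_sum_maximal[OF finite_atLeastAtMost bound this]
  have "\<forall>i\<in>{1..N}. to_complex (ip (F i) (G i)) = of_real t"
    by blast
  with FG show ?thesis
    unfolding one_uniform_def by blast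
qed

end
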